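(* Let $f:\mathbb{R}^n\to\mathbb{R}$ be convex and $L$-smooth ($L>0$), with a minimizer $x^*$ and $f^*=f(x^* )$. Let $\{x_k\}_{k\ge0}$ be generated from a deterministic initialization $x_0=x_1\in\mathbb{R}^n$ by $$x_{k+1}=x_k+\frac{k}{k+2}(x_k-x_{k-1})-\frac{2\sqrt{\eta_k}}{(k+2)\sqrt{k}}\,g(x_k,\xi_k),\qquad k\ge1,$$ with stepsize $\eta_k=\frac{1}{L^2\log^2(k+2)}$. Let $\mathcal{F}_k=\sigma(\xi_1,\dots,\xi_{k-1})$ and suppose that, for some $\sigma\ge 0$ and every $k\ge1$, $$\mathbb{E}[g(x_k,\xi_k)\mid\mathcal{F}_k]=\nabla f(x_k),\qquad \mathbb{E}[\|g(x_k,\xi_k)\|^2\mid\mathcal{F}_k]\le\|\nabla f(x_k)\|^2+\sigma^2.$$ Let $\{r_k\}$ be a sequence of real numbers with $\lim_{k\to\infty}r_k=0$. Then, almost surely, $$\lim_{k\to\infty}r_k\cdot\frac{\sqrt{k}}{\log k}\cdot(f(x_k)-f^* )=0$$ and $$\liminf_{k\to\infty}\left(\sqrt{k}\,\log\log(k+2)\right)\left(f(x_k)-f^*\right)=0.$$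
   Context: $\|\cdot\|$ is the Euclidean norm. $f$ is $L$-smooth if it is differentiable and $\|\nabla f(x)-\nabla f(y)\|\le L\|x-y\|$ for all $x,y\in\mathbb{R}^n$. $g(x,\xi)$ is the output of a stochastic gradient oracle queried at $x$ with randomness $\xi$; $\mathcal{F}_k$ is the $\sigma$-algebra generated by all randomness after arriving at $x_k$. $\log$ is the natural logarithm and $\log^2(k+2)=(\log(k+2))^2$. *)

theory Defs
  imports "HOL-Probability.Probability"
begin

definition gradient :: "('a::real_inner \<Rightarrow> real) \<Rightarrow> 'a \<Rightarrow> 'a" where
  "gradient f x = (THE D. GDERIV f x :> D)"

definition L_smooth :: "real \<Rightarrow> ('a::euclidean_space \<Rightarrow> real) \<Rightarrow> bool" where
  "L_smooth L f \<longleftrightarrow>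
     (\<forall>x. f differentiable (at x)) \<and>
     (\<forall>x y. norm (gradient f x - gradient f y) \<le> L * norm (x - y))"

lemma GDERIV_gradient:
  fixes f :: "'a::euclidean_space \<Rightarrow> real"
  assumes "f differentiable (at x)"
  shows "GDERIV f x :> gradient f x"
proof -
  obtain f' where f': "(f has_derivative f') (at x)"
    using assms by (auto simp: differentiable_def)
  then interpret bounded_linear f' by (rule has_derivative_bounded_linear)
  have "f' = (\<lambda>h. h \<bullet> (\<Sum>b\<in>Basis. f' b *\<^sub>R b))"
  proof
    fix h
    have "f' h = f' (\<Sum>b\<in>Basis. (h \<bullet> b) *\<^sub>R b)" by (simp add: euclidean_representation)
    also have "\<dots> = (\<Sum>b\<in>Basis. (h \<bullet> b) * f' b)" by (simp add: sum scale)
    also have "\<dots> = h \<bullet> (\<Sum>b\<in>Basis. f' b *\<^sub>R b)"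
      by (simp add: inner_sum_right mult.commute)
    finally show "f' h = h \<bullet> (\<Sum>b\<in>Basis. f' b *\<^sub>R b)" .
  qed
  with f' have ex: "GDERIV f x :> (\<Sum>b\<in>Basis. f' b *\<^sub>R b)"
    by (simp add: gderiv_def)
  moreover have "D = E" if "GDERIV f x :> D" "GDERIV f x :> E" for D E
  proof -
    have "(\<lambda>h. h \<bullet> D) = (\<lambda>h. h \<bullet> E)"
      using that unfolding gderiv_def by (rule has_derivative_unique)
    then have "h \<bullet> D = h \<bullet> E" for h by metis
    then show ?thesis by (metis vector_eq_ldot)
  qed
  ultimately show ?thesis
    unfolding gradient_def by (intro theI[of "\<lambda>D. GDERIV f x :> D"]) blast+
qed

text \<open>
  The \<open>\<sigma>\<close>-algebra generated by \<open>\<xi> 1, \<dots>, \<xi> (k - 1)\<close>, as a measure space of which only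
  the underlying space and the measurable sets matter. For \<open>k \<le> 1\<close> it is the trivial one.
\<close>

definition past_sigma ::
  "'w measure \<Rightarrow> 'x measure \<Rightarrow> (nat \<Rightarrow> 'w \<Rightarrow> 'x) \<Rightarrow> nat \<Rightarrow> 'w measure" where
  "past_sigma M N \<xi> k =
     sigma (space M) (\<Union>i\<in>{1..<k}. {\<xi> i -` A \<inter> space M | A. A \<in> sets N})"

text \<open>
  The library's conditional expectation is real-valued; for vectors it is taken coordinatewise.
\<close>

definition vec_cond_exp ::
  "'w measure \<Rightarrow> 'w measure \<Rightarrow> ('w \<Rightarrow> real ^ 'n) \<Rightarrow> 'w \<Rightarrow> real ^ 'n" where
  "vec_cond_exp M F X \<omega> = (\<chi> i. real_cond_exp M F (\<lambda>\<omega>'. X \<omega>' $ i) \<omega>)"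

definition stepsize :: "real \<Rightarrow> nat \<Rightarrow> real" where
  "stepsize L k = 1 / (L\<^sup>2 * (ln (real k + 2))\<^sup>2)"

end

theory Submission
  imports Defs "HOL-Real_Asymp.Real_Asymp"
begin

text \<open>
  The momentum iteration is stochastic gradient descent in disguise. Write
  \<open>\<alpha>\<^sub>k = 2 \<surd>\<eta>\<^sub>k / \<surd>k\<close> and \<open>z\<^sub>k = x\<^sub>k\<^sub>+\<^sub>1 + (k + 1) (x\<^sub>k\<^sub>+\<^sub>1 - x\<^sub>k)\<close>. Multiplying the recursion by
  \<open>k + 2\<close> turns it into \<open>z\<^sub>k\<^sub>+\<^sub>1 = z\<^sub>k - \<alpha>\<^sub>k\<^sub>+\<^sub>1 g\<^sub>k\<^sub>+\<^sub>1\<close>, where the gradient is sampled at the averaged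
  point \<open>x\<^sub>k\<^sub>+\<^sub>1\<close> (lemma \<open>z_Suc\<close>).

  Write \<open>\<Delta>\<^sub>k = f x\<^sub>k - f x\<^sup>*\<close>. Expanding \<open>\<parallel>z\<^sub>k\<^sub>+\<^sub>1 - x\<^sup>*\<parallel>\<^sup>2\<close> and splitting
  \<open>z\<^sub>k - x\<^sup>* = (x\<^sub>k\<^sub>+\<^sub>1 - x\<^sup>*) + (k + 1) (x\<^sub>k\<^sub>+\<^sub>1 - x\<^sub>k)\<close>, convexity makes the
  gaps telescope: \<open>\<parallel>z\<^sub>k - x\<^sup>*\<parallel>\<^sup>2 + 2 \<alpha>\<^sub>k (k + 1) \<Delta>\<^sub>k\<close> decreases in conditional mean, up to a
  variance term \<open>\<sigma>\<^sup>2 \<alpha>\<^sub>k\<^sub>+\<^sub>1\<^sup>2\<close>, by at least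
  \<open>2 (k + 1) (\<alpha>\<^sub>k - \<alpha>\<^sub>k\<^sub>+\<^sub>1) \<Delta>\<^sub>k \<ge> \<alpha>\<^sub>k\<^sub>+\<^sub>1 \<Delta>\<^sub>k\<close> (lemma \<open>energy_decrease\<close>). Smoothness contributes a
  squared gradient norm that absorbs the multiplicative part of the noise as soon as
  \<open>L \<alpha>\<^sub>k\<^sub>+\<^sub>1 \<le> 1\<close>. The variances are summable, because \<open>1 / (k ln\<^sup>2 k)\<close> is.

  Adding to the energy the decreases so far and the variances still to come gives a nonnegative
  supermartingale, which a maximal inequality shows to be bounded almost surely. This yields the
  two facts of lemma \<open>gap_rates\<close>: \<open>\<alpha>\<^sub>k (k + 1) \<Delta>\<^sub>k\<close> is bounded and \<open>\<Sum> \<alpha>\<^sub>k\<^sub>+\<^sub>1 \<Delta>\<^sub>k\<close> converges. As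
  \<open>\<alpha>\<^sub>k\<close> is of order \<open>1 / (\<surd>k ln k)\<close>, the first says \<open>\<Delta>\<^sub>k = O(ln k / \<surd>k)\<close>, hence the limit with the
  factor \<open>r\<close>. If the limit inferior were positive, the second would make
  \<open>1 / (k ln k ln ln k)\<close> summable, which it is not.
\<close>

section \<open>Convex smooth functions\<close>

lemma L_smooth_line_derivative:
  fixes f :: "'a::euclidean_space \<Rightarrow> real"
  assumes "L_smooth L f"
  shows "((\<lambda>t. f (x + t *\<^sub>R h)) has_real_derivative gradient f (x + t *\<^sub>R h) \<bullet> h) (at t)"
proof -
  have "(f has_derivative (\<lambda>v. v \<bullet> gradient f (x + t *\<^sub>R h))) (at (x + t *\<^sub>R h))"
    using assms GDERIV_gradient[of f "x + t *\<^sub>R h"] by (simp add: L_smooth_def gderiv_def)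
  moreover have "((\<lambda>t. x + t *\<^sub>R h) has_derivative (\<lambda>s. s *\<^sub>R h)) (at t)"
    by (auto intro!: derivative_eq_intros)
  ultimately have "((\<lambda>t. f (x + t *\<^sub>R h)) has_derivative
      (\<lambda>s. (s *\<^sub>R h) \<bullet> gradient f (x + t *\<^sub>R h))) (at t)"
    by (rule has_derivative_compose[rotated])
  then show ?thesis
    by (rule has_derivative_imp_has_field_derivative) (simp add: inner_commute)
qed

text \<open>
  Along the segment from \<open>x\<close> to \<open>y\<close> the difference of the two sides is monotone: the Lipschitz bound
  controls how far the slope of \<open>f\<close> can drift from its initial value.
\<close>

lemma L_smooth_upper_bound:
  fixes f :: "'a::euclidean_space \<Rightarrow> real"
  assumes smooth: "L_smooth L f"
  shows "f y \<le> f x + gradient f x \<bullet> (y - x) + L / 2 * (norm (y - x))\<^sup>2"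
proof -
  define h where "h = y - x"
  define p where "p t = f (x + t *\<^sub>R h) - t * (gradient f x \<bullet> h) - L / 2 * t\<^sup>2 * (norm h)\<^sup>2" for t
  have "p 1 \<le> p 0"
  proof (rule DERIV_nonpos_imp_nonincreasing[of 0 1 p])
    fix t :: real assume t: "0 \<le> t" "t \<le> 1"
    let ?d = "gradient f (x + t *\<^sub>R h) \<bullet> h - gradient f x \<bullet> h - L * t * (norm h)\<^sup>2"
    have "(p has_real_derivative ?d) (at t)"
      unfolding p_def
      by (auto intro!: derivative_eq_intros L_smooth_line_derivative[OF smooth])
    moreover have "?d \<le> 0"
    proof -
      have "gradient f (x + t *\<^sub>R h) \<bullet> h - gradient f x \<bullet> h
          \<le> norm (gradient f (x + t *\<^sub>R h) - gradient f x) * norm h"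
        by (metis inner_diff_left norm_cauchy_schwarz)
      also have "\<dots> \<le> (L * norm (x + t *\<^sub>R h - x)) * norm h"
        using smooth unfolding L_smooth_def by (intro mult_right_mono) (blast, simp)
      also have "\<dots> = L * t * (norm h)\<^sup>2"
        using t by (simp add: power2_eq_square)
      finally show ?thesis by simp
    qed
    ultimately show "\<exists>y. DERIV p t :> y \<and> y \<le> 0" by blast
  qed simp
  then show ?thesis by (simp add: p_def h_def)
qed

lemma convex_tangent_below:
  fixes f :: "'a::euclidean_space \<Rightarrow> real"
  assumes smooth: "L_smooth L f" and convex: "convex_on UNIV f"
  shows "f x + gradient f x \<bullet> (y - x) \<le> f y"
proof -
  define p where "p t = f (x + t *\<^sub>R (y - x))" for t :: real
  have "convex_on UNIV p"
  proof (rule convex_onI)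
    fix t a b :: real assume t: "0 < t" "t < 1"
    have "x + ((1 - t) *\<^sub>R a + t *\<^sub>R b) *\<^sub>R (y - x)
        = (1 - t) *\<^sub>R (x + a *\<^sub>R (y - x)) + t *\<^sub>R (x + b *\<^sub>R (y - x))"
      by (simp add: algebra_simps)
    then show "p ((1 - t) *\<^sub>R a + t *\<^sub>R b) \<le> (1 - t) * p a + t * p b"
      using convex_onD[OF convex, of t] t by (simp add: p_def)
  qed simp
  moreover have "(p has_real_derivative gradient f x \<bullet> (y - x)) (at 0)"
    using L_smooth_line_derivative[OF smooth, of x "y - x" 0] by (simp add: p_def[abs_def])
  ultimately have "gradient f x \<bullet> (y - x) * (1 - 0) \<le> p 1 - p 0"
    using convex_on_imp_above_tangent[of UNIV p 0 1] by simp
  then show ?thesis by (simp add: p_def)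
qed

lemma gradient_minimizer_eq_0:
  fixes f :: "'a::euclidean_space \<Rightarrow> real"
  assumes smooth: "L_smooth L f" and min: "\<And>y. f m \<le> f y"
  shows "gradient f m = 0"
proof -
  have "((\<lambda>t. f (m + t *\<^sub>R gradient f m)) has_real_derivative
      gradient f m \<bullet> gradient f m) (at 0)"
    using L_smooth_line_derivative[OF smooth, of m "gradient f m" 0] by simp
  then have "gradient f m \<bullet> gradient f m = 0"
    by (rule DERIV_local_min[where d = 1]) (auto simp: min)
  then show ?thesis by simp
qed

text \<open>
  Take a gradient step of length \<open>1 / L\<close> away from the minimizer, in the direction \<open>gradient f x\<close>.
  At its endpoint, smoothness at the minimizer bounds \<open>f\<close> from above and the tangent at \<open>x\<close> bounds it
  from below. The extra squared gradient norm, compared with plain convexity, is what later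
  pays for the part of the noise that grows with the gradient.
\<close>

lemma gradient_toward_minimizer:
  fixes f :: "'a::euclidean_space \<Rightarrow> real"
  assumes smooth: "L_smooth L f" and convex: "convex_on UNIV f" and L: "L > 0"
    and min: "\<And>y. f m \<le> f y"
  shows "f x - f m + (norm (gradient f x))\<^sup>2 / (2 * L) \<le> gradient f x \<bullet> (x - m)"
proof -
  define y where "y = m + (1 / L) *\<^sub>R gradient f x"
  have "f y \<le> f m + L / 2 * (norm (y - m))\<^sup>2"
    using L_smooth_upper_bound[OF smooth, of y m] gradient_minimizer_eq_0[OF smooth min] by simp
  also have "L / 2 * (norm (y - m))\<^sup>2 = (norm (gradient f x))\<^sup>2 / (2 * L)"
    using L by (simp add: y_def power2_eq_square field_simps)
  finally have upper: "f y \<le> f m + (norm (gradient f x))\<^sup>2 / (2 * L)" .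
  have "f x + gradient f x \<bullet> (y - x) \<le> f y"
    by (rule convex_tangent_below[OF smooth convex])
  also have "gradient f x \<bullet> (y - x) = (norm (gradient f x))\<^sup>2 / L - gradient f x \<bullet> (x - m)"
    by (simp add: y_def inner_simps power2_norm_eq_inner)
  finally show ?thesis using upper by (simp add: field_simps)
qed

lemma L_smooth_borel_measurable:
  fixes f :: "'a::euclidean_space \<Rightarrow> real"
  assumes smooth: "L_smooth L f"
  shows "f \<in> borel_measurable borel" "gradient f \<in> borel_measurable borel"
proof -
  have "continuous_on UNIV f"
    using smooth by (auto simp: L_smooth_def continuous_on_eq_continuous_within
        intro: differentiable_imp_continuous_within)
  then show "f \<in> borel_measurable borel" by (rule borel_measurable_continuous_onI)
  have "(max L 0)-lipschitz_on UNIV (gradient f)"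
  proof (rule lipschitz_onI)
    fix x y :: 'a
    have "norm (gradient f x - gradient f y) \<le> L * norm (x - y)"
      using smooth by (simp add: L_smooth_def)
    also have "\<dots> \<le> max L 0 * norm (x - y)" by (intro mult_right_mono) auto
    finally show "dist (gradient f x) (gradient f y) \<le> max L 0 * dist x y"
      by (simp add: dist_norm)
  qed simp
  then have "continuous_on UNIV (gradient f)" by (rule lipschitz_on_continuous_on)
  then show "gradient f \<in> borel_measurable borel" by (rule borel_measurable_continuous_onI)
qed

section \<open>Square-integrable random vectors\<close>

definition square_integrable :: "'w measure \<Rightarrow> ('w \<Rightarrow> 'a::euclidean_space) \<Rightarrow> bool" where
  "square_integrable M X \<longleftrightarrow> X \<in> borel_measurable M \<and> integrable M (\<lambda>\<omega>. (norm (X \<omega>))\<^sup>2)"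

lemma square_integrable_cong:
  assumes "square_integrable M X" "\<And>\<omega>. \<omega> \<in> space M \<Longrightarrow> X \<omega> = Y \<omega>"
  shows "square_integrable M Y"
  using assms unfolding square_integrable_def
  by (auto cong: measurable_cong Bochner_Integration.integrable_cong)

lemma square_integrable_add:
  assumes "square_integrable M X" "square_integrable M Y"
  shows "square_integrable M (\<lambda>\<omega>. X \<omega> + Y \<omega>)"
proof -
  have [measurable]: "X \<in> borel_measurable M" "Y \<in> borel_measurable M"
    using assms by (auto simp: square_integrable_def)
  have "integrable M (\<lambda>\<omega>. (norm (X \<omega> + Y \<omega>))\<^sup>2)"
  proof (rule Bochner_Integration.integrable_bound)
    show "integrable M (\<lambda>\<omega>. 2 * (norm (X \<omega>))\<^sup>2 + 2 * (norm (Y \<omega>))\<^sup>2)"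
      using assms by (auto simp: square_integrable_def)
    have "(norm (X \<omega> + Y \<omega>))\<^sup>2 \<le> 2 * (norm (X \<omega>))\<^sup>2 + 2 * (norm (Y \<omega>))\<^sup>2" for \<omega>
    proof -
      have "(norm (X \<omega> + Y \<omega>))\<^sup>2 \<le> (norm (X \<omega>) + norm (Y \<omega>))\<^sup>2"
        by (intro power_mono norm_triangle_ineq) simp
      also have "\<dots> \<le> 2 * (norm (X \<omega>))\<^sup>2 + 2 * (norm (Y \<omega>))\<^sup>2"
        using zero_le_power2[of "norm (X \<omega>) - norm (Y \<omega>)"]
        by (simp add: power2_sum power2_diff)
      finally show ?thesis .
    qed
    then show "AE \<omega> in M. norm ((norm (X \<omega> + Y \<omega>))\<^sup>2) \<le> norm (2 * (norm (X \<omega>))\<^sup>2 + 2 * (norm (Y \<omega>))\<^sup>2)"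
      by simp
  qed measurable
  then show ?thesis by (simp add: square_integrable_def)
qed

lemma square_integrable_scaleR:
  assumes "square_integrable M X"
  shows "square_integrable M (\<lambda>\<omega>. c *\<^sub>R X \<omega>)"
  using assms by (auto simp: square_integrable_def power_mult_distrib)

lemma square_integrable_diff:
  assumes "square_integrable M X" "square_integrable M Y"
  shows "square_integrable M (\<lambda>\<omega>. X \<omega> - Y \<omega>)"
  using square_integrable_add[OF assms(1) square_integrable_scaleR[OF assms(2), of "-1"]] by simp

lemma square_integrable_const:
  assumes "finite_measure M"
  shows "square_integrable M (\<lambda>_. c)"
  using assms by (auto simp: square_integrable_def finite_measure.integrable_const)

lemma square_integrable_bound:
  assumes "square_integrable M X" "Y \<in> borel_measurable M"
    and "\<And>\<omega>. \<omega> \<in> space M \<Longrightarrow> norm (Y \<omega>) \<le> c * norm (X \<omega>)"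
  shows "square_integrable M Y"
proof -
  have [measurable]: "X \<in> borel_measurable M" "Y \<in> borel_measurable M"
    using assms by (auto simp: square_integrable_def)
  have "integrable M (\<lambda>\<omega>. (norm (Y \<omega>))\<^sup>2)"
  proof (rule Bochner_Integration.integrable_bound)
    show "integrable M (\<lambda>\<omega>. c\<^sup>2 * (norm (X \<omega>))\<^sup>2)"
      using assms by (auto simp: square_integrable_def)
    have "(norm (Y \<omega>))\<^sup>2 \<le> c\<^sup>2 * (norm (X \<omega>))\<^sup>2" if "\<omega> \<in> space M" for \<omega>
      using power_mono[OF assms(3)[OF that], of 2] by (simp add: power_mult_distrib)
    then show "AE \<omega> in M. norm ((norm (Y \<omega>))\<^sup>2) \<le> norm (c\<^sup>2 * (norm (X \<omega>))\<^sup>2)"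
      by simp
  qed measurable
  then show ?thesis using assms by (simp add: square_integrable_def)
qed

lemma square_integrable_inner:
  assumes "square_integrable M X" "square_integrable M Y"
  shows "integrable M (\<lambda>\<omega>. X \<omega> \<bullet> Y \<omega>)"
proof (rule Bochner_Integration.integrable_bound)
  show "integrable M (\<lambda>\<omega>. (norm (X \<omega>))\<^sup>2 + (norm (Y \<omega>))\<^sup>2)"
    using assms by (auto simp: square_integrable_def)
  have [measurable]: "X \<in> borel_measurable M" "Y \<in> borel_measurable M"
    using assms by (auto simp: square_integrable_def)
  show "(\<lambda>\<omega>. X \<omega> \<bullet> Y \<omega>) \<in> borel_measurable M" by measurable
  have "\<bar>X \<omega> \<bullet> Y \<omega>\<bar> \<le> (norm (X \<omega>))\<^sup>2 + (norm (Y \<omega>))\<^sup>2" for \<omega>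
  proof -
    have "\<bar>X \<omega> \<bullet> Y \<omega>\<bar> \<le> norm (X \<omega>) * norm (Y \<omega>)" by (rule Cauchy_Schwarz_ineq2)
    also have "\<dots> \<le> 2 * norm (X \<omega>) * norm (Y \<omega>)" by simp
    also have "\<dots> \<le> (norm (X \<omega>))\<^sup>2 + (norm (Y \<omega>))\<^sup>2" by (rule sum_squares_bound)
    finally show ?thesis .
  qed
  then show "AE \<omega> in M. norm (X \<omega> \<bullet> Y \<omega>) \<le> norm ((norm (X \<omega>))\<^sup>2 + (norm (Y \<omega>))\<^sup>2)"
    by simp
qed

section \<open>Integrals of conditional expectations\<close>

text \<open>
  Conditioning is used only through its integrals against \<open>F\<close>-measurable weights. For vectors,
  each coordinate of the weight can be moved inside the conditional expectation of the
  corresponding coordinate.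
\<close>

lemma (in sigma_finite_subalgebra) integral_inner_vec_cond_exp:
  fixes G W H :: "'a \<Rightarrow> real ^ 'n"
  assumes W: "square_integrable M W" "W \<in> borel_measurable F"
    and G: "square_integrable M G"
    and H: "AE \<omega> in M. vec_cond_exp M F G \<omega> = H \<omega>" 
      "H \<in> borel_measurable M"
  shows "(\<integral>\<omega>. G \<omega> \<bullet> W \<omega> \<partial>M) = (\<integral>\<omega>. H \<omega> \<bullet> W \<omega> \<partial>M)"
proof -
  let ?c = "\<lambda>i. real_cond_exp M F (\<lambda>\<omega>. G \<omega> $ i)"
  have GM: "G \<in> borel_measurable M" and WM: "W \<in> borel_measurable M"
    using W G by (auto simp: square_integrable_def)
  have WiF: "(\<lambda>\<omega>. W \<omega> $ i) \<in> borel_measurable F" for i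
    using borel_measurable_inner[OF W(2) borel_measurable_const[of "axis i (1::real)"]]
    by (simp add: inner_axis)
  have GiM: "(\<lambda>\<omega>. G \<omega> $ i) \<in> borel_measurable M" for i
    using borel_measurable_inner[OF GM borel_measurable_const[of "axis i (1::real)"]]
    by (simp add: inner_axis)
  have WiM: "(\<lambda>\<omega>. W \<omega> $ i) \<in> borel_measurable M" for i
    using borel_measurable_inner[OF WM borel_measurable_const[of "axis i (1::real)"]]
    by (simp add: inner_axis)
  have Wi: "square_integrable M (\<lambda>\<omega>. W \<omega> $ i)" for i
    using square_integrable_bound[OF W(1) WiM, where c = 1] by (simp add: component_le_norm_cart)
  have Gi: "square_integrable M (\<lambda>\<omega>. G \<omega> $ i)" for i
    using square_integrable_bound[OF G GiM, where c = 1] by (simp add: component_le_norm_cart)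
  have int: "integrable M (\<lambda>\<omega>. W \<omega> $ i * G \<omega> $ i)" for i
    using square_integrable_inner[OF Wi Gi] by simp
  note pull = real_cond_exp_intg[OF int WiF GiM]
  have "(\<integral>\<omega>. G \<omega> \<bullet> W \<omega> \<partial>M) = (\<integral>\<omega>. (\<Sum>i\<in>UNIV. W \<omega> $ i * G \<omega> $ i) \<partial>M)"
    by (simp add: inner_vec_def mult.commute)
  also have "\<dots> = (\<Sum>i\<in>UNIV. \<integral>\<omega>. W \<omega> $ i * ?c i \<omega> \<partial>M)"
    by (simp add: Bochner_Integration.integral_sum int pull(2))
  also have "\<dots> = (\<integral>\<omega>. (\<Sum>i\<in>UNIV. W \<omega> $ i * ?c i \<omega>) \<partial>M)"
    by (simp add: Bochner_Integration.integral_sum pull(1))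
  also have "\<dots> = (\<integral>\<omega>. H \<omega> \<bullet> W \<omega> \<partial>M)"
  proof (rule integral_cong_AE)
    show "(\<lambda>\<omega>. \<Sum>i\<in>UNIV. W \<omega> $ i * ?c i \<omega>) \<in> borel_measurable M"
      using pull(1) by (intro borel_measurable_sum) auto
    show "(\<lambda>\<omega>. H \<omega> \<bullet> W \<omega>) \<in> borel_measurable M"
      using H(2) WM by simp
    show "AE \<omega> in M. (\<Sum>i\<in>UNIV. W \<omega> $ i * ?c i \<omega>) = H \<omega> \<bullet> W \<omega>"
      using H(1)
    proof eventually_elim
      case (elim \<omega>)
      have "?c i \<omega> = H \<omega> $ i" for i
        using arg_cong[OF elim, of "\<lambda>v. v $ i"] by (simp add: vec_cond_exp_def)
      then show ?case by (simp add: inner_vec_def mult.commute)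
    qed
  qed
  finally show ?thesis .
qed

text \<open>
  A conditional bound by an integrable function also supplies integrability, which is not known
  beforehand for the squared norm of the oracle output.
\<close>

lemma (in sigma_finite_subalgebra) integral_le_of_nn_cond_exp_le:
  fixes X Y :: "'a \<Rightarrow> real"
  assumes X: "X \<in> borel_measurable M" "\<And>\<omega>. \<omega> \<in> space M \<Longrightarrow> 0 \<le> X \<omega>"
    and Y: "integrable M Y" "\<And>\<omega>. \<omega> \<in> space M \<Longrightarrow> 0 \<le> Y \<omega>"
    and le: "AE \<omega> in M. nn_cond_exp M F (\<lambda>\<omega>. ennreal (X \<omega>)) \<omega> \<le> ennreal (Y \<omega>)"
  shows "integrable M X"
    and "A \<in> sets F \<Longrightarrow> (\<integral>\<omega>. indicator A \<omega> * X \<omega> \<partial>M) \<le> (\<integral>\<omega>. indicator A \<omega> * Y \<omega> \<partial>M)"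
proof -
  have nn: "(\<integral>\<^sup>+\<omega>. ennreal (indicator A \<omega> * X \<omega>) \<partial>M) \<le> (\<integral>\<^sup>+\<omega>. ennreal (indicator A \<omega> * Y \<omega>) \<partial>M)"
    if A: "A \<in> sets F" for A
  proof -
    have "(\<integral>\<^sup>+\<omega>. ennreal (indicator A \<omega> * X \<omega>) \<partial>M) = (\<integral>\<^sup>+\<omega>. indicator A \<omega> * ennreal (X \<omega>) \<partial>M)"
      by (intro nn_integral_cong) (auto split: split_indicator)
    also have "\<dots> = (\<integral>\<^sup>+\<omega>. indicator A \<omega> * nn_cond_exp M F (\<lambda>\<omega>. ennreal (X \<omega>)) \<omega> \<partial>M)"
      using A X(1) by (intro nn_cond_exp_intg[symmetric]) auto
    also have "\<dots> \<le> (\<integral>\<^sup>+\<omega>. ennreal (indicator A \<omega> * Y \<omega>) \<partial>M)"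
      using le by (intro nn_integral_mono_AE) (auto split: split_indicator elim: eventually_mono)
    finally show ?thesis .
  qed
  have F: "space M \<in> sets F" "sets F \<subseteq> sets M"
    using subalg sets.top[of F] by (auto simp: subalgebra_def)
  have "(\<integral>\<^sup>+\<omega>. ennreal (X \<omega>) \<partial>M) = (\<integral>\<^sup>+\<omega>. ennreal (indicator (space M) \<omega> * X \<omega>) \<partial>M)"
    by (intro nn_integral_cong) auto
  also have "\<dots> \<le> (\<integral>\<^sup>+\<omega>. ennreal (indicator (space M) \<omega> * Y \<omega>) \<partial>M)" by (rule nn[OF F(1)])
  also have "\<dots> = (\<integral>\<^sup>+\<omega>. ennreal (Y \<omega>) \<partial>M)" by (intro nn_integral_cong) auto
  also have "\<dots> = ennreal (\<integral>\<omega>. Y \<omega> \<partial>M)" using Y by (intro nn_integral_eq_integral) auto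
  also have "\<dots> < \<infinity>" by simp
  finally show X_int: "integrable M X"
    using X by (intro integrableI_nonneg) auto
  assume A: "A \<in> sets F"
  have int: "integrable M (\<lambda>\<omega>. indicator A \<omega> * X \<omega>)" "integrable M (\<lambda>\<omega>. indicator A \<omega> * Y \<omega>)"
    using A F(2) X_int Y(1)
    by (auto intro!: integrable_mult_indicator[where 'b=real, simplified])
  have "ennreal (\<integral>\<omega>. indicator A \<omega> * X \<omega> \<partial>M) = (\<integral>\<^sup>+\<omega>. ennreal (indicator A \<omega> * X \<omega>) \<partial>M)"
    using X(2) int(1) by (intro nn_integral_eq_integral[symmetric]) auto
  also have "\<dots> \<le> (\<integral>\<^sup>+\<omega>. ennreal (indicator A \<omega> * Y \<omega>) \<partial>M)" by (rule nn[OF A])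
  also have "\<dots> = ennreal (\<integral>\<omega>. indicator A \<omega> * Y \<omega> \<partial>M)"
    using Y(2) int(2) by (intro nn_integral_eq_integral) auto
  finally show "(\<integral>\<omega>. indicator A \<omega> * X \<omega> \<partial>M) \<le> (\<integral>\<omega>. indicator A \<omega> * Y \<omega> \<partial>M)"
    using Y(2) by (subst (asm) ennreal_le_iff) (auto intro!: integral_nonneg)
qed

section \<open>A maximal inequality for nonnegative supermartingales\<close>

text \<open>
  Doob's argument, with the stopped process written out: as long as all earlier values are below
  \<open>c\<close> follow \<open>S\<close>, and from the first crossing on keep the value \<open>c\<close>. Its mean does not increase,
  since stopping replaces a value of at least \<open>c\<close> by \<open>c\<close>, and it dominates \<open>c\<close> times the probability of a
  crossing.
\<close>

lemma (in prob_space) supermartingale_maximal_inequality: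
  fixes S :: "nat \<Rightarrow> 'a \<Rightarrow> real"
  assumes subalg: "\<And>n. subalgebra M (F n)" and mono: "\<And>m n. m \<le> n \<Longrightarrow> sets (F m) \<subseteq> sets (F n)"
    and adapted: "\<And>n. S n \<in> borel_measurable (F n)"
    and integrable: "\<And>n. integrable M (S n)"
    and nonneg: "\<And>n \<omega>. \<omega> \<in> space M \<Longrightarrow> 0 \<le> S n \<omega>"
    and decrease: "\<And>n A. A \<in> sets (F n) \<Longrightarrow>
      (\<integral>\<omega>. indicator A \<omega> * S (Suc n) \<omega> \<partial>M) \<le> (\<integral>\<omega>. indicator A \<omega> * S n \<omega> \<partial>M)"
    and c: "c > 0"
  shows "c * prob {\<omega> \<in> space M. \<exists>j<n. c \<le> S j \<omega>} \<le> expectation (S 0)"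
proof -
  define A where "A n = {\<omega> \<in> space M. \<forall>j<n. S j \<omega> < c}" for n
  have A_F: "A (Suc n) \<in> sets (F n)" for n
  proof -
    have "{\<omega> \<in> space (F n). S j \<omega> < c} \<in> sets (F n)" if "j \<le> n" for j
    proof -
      have "subalgebra (F n) (F j)"
        using subalg[of n] subalg[of j] mono[OF that] by (simp add: subalgebra_def)
      then have "S j \<in> borel_measurable (F n)"
        using adapted[of j] by (rule measurable_from_subalg)
      then show ?thesis by measurable
    qed
    moreover have "A (Suc n) = (\<Inter>j\<in>{..n}. {\<omega> \<in> space (F n). S j \<omega> < c})"
      using subalg[of n] by (auto simp: A_def subalgebra_def less_Suc_eq_le)
    ultimately show ?thesis by (auto intro!: sets.finite_INT)
  qed
  have A_M [measurable]: "A n \<in> events" for n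
  proof (cases n)
    case 0
    then have "A n = space M" by (auto simp: A_def)
    then show ?thesis by simp
  next
    case (Suc m)
    then show ?thesis using A_F[of m] subalg[of m] by (auto simp only: subalgebra_def)
  qed
  \<comment> \<open>the mean of the stopped process\<close>
  define W where "W n = (\<integral>\<omega>. indicator (A n) \<omega> * S n \<omega> + c * indicator (space M - A n) \<omega> \<partial>M)" for n
  have int: "integrable M (\<lambda>\<omega>. indicator (A m) \<omega> * S n \<omega>)"
    "integrable M (\<lambda>\<omega>. c * indicator (space M - A m) \<omega>)" for m n
  proof -
    show "integrable M (\<lambda>\<omega>. indicator (A m) \<omega> * S n \<omega>)"
      using integrable_mult_indicator[OF A_M integrable, of m n] by simp
    show "integrable M (\<lambda>\<omega>. c * indicator (space M - A m) \<omega>)"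
      by (intro Bochner_Integration.integrable_mult_right integrable_real_indicator)
        (auto simp: less_top[symmetric])
  qed
  have W_Suc: "W (Suc n) \<le> W n" for n
  proof -
    have "W (Suc n) \<le> (\<integral>\<omega>. indicator (A (Suc n)) \<omega> * S n \<omega> + c * indicator (space M - A (Suc n)) \<omega> \<partial>M)"
      using decrease[OF A_F[of n]]
      unfolding W_def Bochner_Integration.integral_add[OF int(1) int(2)] by simp
    also have "\<dots> \<le> W n"
      unfolding W_def
    proof (rule integral_mono)
      fix \<omega> assume "\<omega> \<in> space M"
      show "indicator (A (Suc n)) \<omega> * S n \<omega> + c * indicator (space M - A (Suc n)) \<omega>
          \<le> indicator (A n) \<omega> * S n \<omega> + c * indicator (space M - A n) \<omega>"
      proof -
        have "\<omega> \<in> A (Suc n) \<longleftrightarrow> \<omega> \<in> A n \<and> S n \<omega> < c"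
          by (auto simp: A_def less_Suc_eq)
        with \<open>\<omega> \<in> space M\<close> show ?thesis by (simp add: indicator_def)
      qed
    qed (intro Bochner_Integration.integrable_add int)+
    finally show ?thesis .
  qed
  have "c * prob (space M - A n) = (\<integral>\<omega>. c * indicator (space M - A n) \<omega> \<partial>M)" by simp
  also have "\<dots> \<le> W n"
    unfolding W_def
  proof (rule integral_mono)
    show "\<omega> \<in> space M \<Longrightarrow> c * indicator (space M - A n) \<omega>
        \<le> indicator (A n) \<omega> * S n \<omega> + c * indicator (space M - A n) \<omega>" for \<omega>
      using nonneg by simp
  qed (intro Bochner_Integration.integrable_add int)+
  also have "W n \<le> W 0" using lift_Suc_antimono_le[of W 0 n] W_Suc by simp
  also have "W 0 = expectation (S 0)"
    unfolding W_def by (intro Bochner_Integration.integral_cong) (auto simp: A_def)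
  also have "space M - A n = {\<omega> \<in> space M. \<exists>j<n. c \<le> S j \<omega>}"
    by (auto simp: A_def not_less)
  finally show ?thesis .
qed

lemma (in prob_space) nonneg_supermartingale_AE_bounded:
  fixes S :: "nat \<Rightarrow> 'a \<Rightarrow> real"
  assumes subalg: "\<And>n. subalgebra M (F n)" and mono: "\<And>m n. m \<le> n \<Longrightarrow> sets (F m) \<subseteq> sets (F n)"
    and adapted: "\<And>n. S n \<in> borel_measurable (F n)"
    and integrable: "\<And>n. integrable M (S n)"
    and nonneg: "\<And>n \<omega>. \<omega> \<in> space M \<Longrightarrow> 0 \<le> S n \<omega>"
    and decrease: "\<And>n A. A \<in> sets (F n) \<Longrightarrow>
      (\<integral>\<omega>. indicator A \<omega> * S (Suc n) \<omega> \<partial>M) \<le> (\<integral>\<omega>. indicator A \<omega> * S n \<omega> \<partial>M)"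
  shows "AE \<omega> in M. \<exists>B. \<forall>n. S n \<omega> \<le> B"
proof -
  have [measurable]: "S n \<in> borel_measurable M" for n using integrable by auto
  define U where "U c n = {\<omega> \<in> space M. \<exists>j<n. real c \<le> S j \<omega>}" for c n :: nat
  have [measurable]: "U c n \<in> events" for c n unfolding U_def by measurable
  define N where "N = {\<omega> \<in> space M. \<forall>c::nat. \<exists>n. real c \<le> S n \<omega>}"
  have N [measurable]: "N \<in> events" unfolding N_def by measurable
  have bound: "real c * prob N \<le> expectation (S 0)" if "c > 0" for c :: nat
  proof -
    have "(\<lambda>n. prob (U c n)) \<longlonglongrightarrow> prob (\<Union>n. U c n)"
    proof (rule finite_Lim_measure_incseq)
      show "incseq (U c)"
        unfolding U_def by (intro incseq_SucI) (auto intro: less_SucI)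
    qed auto
    then have "(\<lambda>n. real c * prob (U c n)) \<longlonglongrightarrow> real c * prob (\<Union>n. U c n)"
      by (intro tendsto_intros)
    then have "real c * prob (\<Union>n. U c n) \<le> expectation (S 0)"
    proof (rule LIMSEQ_le_const2)
      show "\<exists>N. \<forall>n\<ge>N. real c * prob (U c n) \<le> expectation (S 0)"
        using supermartingale_maximal_inequality[where F = F and S = S and c = "real c", OF assms] that
        by (auto simp: U_def)
    qed
    moreover have "prob N \<le> prob (\<Union>n. U c n)"
    proof (rule finite_measure_mono)
      show "N \<subseteq> (\<Union>n. U c n)"
        unfolding N_def U_def using lessI by blast
    qed simp
    ultimately show ?thesis
      using mult_left_mono[of "prob N" "prob (\<Union>n. U c n)" "real c"] by linarith
  qed
  have "prob N = 0"
  proof (rule ccontr)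
    assume "prob N \<noteq> 0"
    then have pos: "prob N > 0" by (simp add: zero_less_measure_iff)
    then obtain c :: nat where "expectation (S 0) < real c * prob N"
      using reals_Archimedean3 by blast
    moreover have "real c * prob N \<le> real (Suc c) * prob N" by (simp add: algebra_simps)
    ultimately show False using bound[of "Suc c"] by linarith
  qed
  then have "AE \<omega> in M. \<omega> \<notin> N" using N by (simp add: prob_eq_0)
  then show ?thesis
  proof (rule AE_mp, intro AE_I2 impI)
    fix \<omega> assume "\<omega> \<in> space M" "\<omega> \<notin> N"
    then obtain c :: nat where "\<And>n. \<not> real c \<le> S n \<omega>" by (auto simp: N_def)
    then show "\<exists>B. \<forall>n. S n \<omega> \<le> B" by (meson linear)
  qed
qed

section \<open>The momentum iteration\<close>

text \<open>
  The analysis uses only four properties of the steps: they are positive, \<open>L \<alpha>\<^sub>k\<close> is eventually at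
  most 1, their squares are summable, and they decay at least about as fast as \<open>1 / \<surd>k\<close>.
  The last is \<open>step_decay\<close>; its constant 2 is the one that \<open>1 / \<surd>k\<close> attains asymptotically.
\<close>

locale stochastic_momentum = prob_space M
  for M :: "'w measure" +
  fixes N :: "'x measure"
    and \<xi> :: "nat \<Rightarrow> 'w \<Rightarrow> 'x"
    and g :: "real ^ 'n \<Rightarrow> 'x \<Rightarrow> real ^ 'n"
    and x :: "nat \<Rightarrow> 'w \<Rightarrow> real ^ 'n"
    and f :: "real ^ 'n \<Rightarrow> real"
    and L \<sigma> :: real
    and x0 xstar :: "real ^ 'n"
    and \<alpha> :: "nat \<Rightarrow> real"
  assumes L_pos: "L > 0"
    and convex: "convex_on UNIV f"
    and smooth: "L_smooth L f"
    and minimizer: "\<And>y. f xstar \<le> f y"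
    and noise_measurable: "\<And>k. k \<ge> 1 \<Longrightarrow> \<xi> k \<in> measurable M N"
    and oracle_measurable: "(\<lambda>(y, z). g y z) \<in> borel_measurable (borel \<Otimes>\<^sub>M N)"
    and init: "\<And>\<omega>. \<omega> \<in> space M \<Longrightarrow> x 0 \<omega> = x0" "\<And>\<omega>. \<omega> \<in> space M \<Longrightarrow> x 1 \<omega> = x0"
    and step: "\<And>k \<omega>. k \<ge> 1 \<Longrightarrow> \<omega> \<in> space M \<Longrightarrow>
      x (k + 1) \<omega> = x k \<omega> + (real k / (real k + 2)) *\<^sub>R (x k \<omega> - x (k - 1) \<omega>)
        - (\<alpha> k / (real k + 2)) *\<^sub>R g (x k \<omega>) (\<xi> k \<omega>)"
    and unbiased: "\<And>k. k \<ge> 1 \<Longrightarrow>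
      AE \<omega> in M. vec_cond_exp M (past_sigma M N \<xi> k) (\<lambda>\<omega>'. g (x k \<omega>') (\<xi> k \<omega>')) \<omega>
        = gradient f (x k \<omega>)"
    and second_moment: "\<And>k. k \<ge> 1 \<Longrightarrow>
      AE \<omega> in M. nn_cond_exp M (past_sigma M N \<xi> k)
          (\<lambda>\<omega>'. ennreal ((norm (g (x k \<omega>') (\<xi> k \<omega>')))\<^sup>2)) \<omega>
        \<le> ennreal ((norm (gradient f (x k \<omega>)))\<^sup>2 + \<sigma>\<^sup>2)"
    and step_pos: "\<And>k. k \<ge> 1 \<Longrightarrow> \<alpha> k > 0"
    and step_decay: "\<And>k. k \<ge> 1 \<Longrightarrow> \<alpha> (Suc k) \<le> 2 * (real k + 1) * (\<alpha> k - \<alpha> (Suc k))"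
    and step_small: "\<forall>\<^sub>F k in sequentially. L * \<alpha> k \<le> 1"
    and step_square_summable: "summable (\<lambda>k. (\<alpha> k)\<^sup>2)"
begin

abbreviation F :: "nat \<Rightarrow> 'w measure" where "F \<equiv> past_sigma M N \<xi>"

abbreviation G :: "nat \<Rightarrow> 'w \<Rightarrow> real ^ 'n" where "G k \<equiv> \<lambda>\<omega>. g (x k \<omega>) (\<xi> k \<omega>)"

definition gap :: "real ^ 'n \<Rightarrow> real" where "gap y = f y - f xstar"

definition z :: "nat \<Rightarrow> 'w \<Rightarrow> real ^ 'n" where
  "z k \<omega> = x (Suc k) \<omega> + (real k + 1) *\<^sub>R (x (Suc k) \<omega> - x k \<omega>)"

text \<open>
  Apart from noise, the step leading to \<open>z k\<close> lowers the mean squared distance to the minimizer by at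
  least this multiple of the gap at \<open>x k\<close>, up to a term in the previous gap, and the next step raises
  it by at most the same multiple with \<open>\<alpha> (Suc k)\<close> in place of \<open>\<alpha> k\<close>. As \<open>\<alpha>\<close> decreases, the energy,
  which keeps the lowering as a credit, does not grow in the mean.
\<close>

definition energy :: "nat \<Rightarrow> 'w \<Rightarrow> real" where
  "energy k \<omega> = (norm (z k \<omega> - xstar))\<^sup>2 + 2 * \<alpha> k * (real k + 1) * gap (x k \<omega>)"

lemma past_generators:
  "(\<Union>i\<in>{1..<k}. {\<xi> i -` A \<inter> space M | A. A \<in> sets N}) \<subseteq> sets M"
  using noise_measurable by (auto intro: measurable_sets)

lemma space_past [simp]: "space (F k) = space M"
  unfolding past_sigma_def by (rule space_measure_of) (use past_generators sets.space_closed in blast)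

lemma sets_past:
  "sets (F k) = sigma_sets (space M) (\<Union>i\<in>{1..<k}. {\<xi> i -` A \<inter> space M | A. A \<in> sets N})"
  unfolding past_sigma_def by (rule sets_measure_of) (use past_generators sets.space_closed in blast)

lemma past_subalgebra: "subalgebra M (F k)"
  unfolding subalgebra_def sets_past using sets.sigma_sets_subset[OF past_generators] by simp

lemma past_mono: "i \<le> j \<Longrightarrow> sets (F i) \<subseteq> sets (F j)"
  unfolding sets_past by (rule sigma_sets_mono') force

text \<open>
  The randomness at index \<open>i\<close> becomes known only after step \<open>i\<close>, so \<open>i = k\<close> is excluded.
\<close>

lemma noise_past:
  assumes "1 \<le> i" "i < k"
  shows "\<xi> i \<in> measurable (F k) N"
proof (rule measurableI)
  show "\<xi> i \<omega> \<in> space N" if "\<omega> \<in> space (F k)" for \<omega>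
    using noise_measurable[OF assms(1)] that by (auto dest: measurable_space)
  show "\<xi> i -` A \<inter> space (F k) \<in> sets (F k)" if "A \<in> sets N" for A
    unfolding sets_past space_past using assms that
    by (intro sigma_sets.Basic UN_I[of i]) auto
qed

text \<open>
  The iterate \<open>x j\<close> is a function of \<open>\<xi> 1, \<dots>, \<xi> (j - 1)\<close>; the statement for all \<open>k \<ge> j\<close> makes
  both predecessors available in the induction.
\<close>

lemma iterate_past: "j \<le> k \<Longrightarrow> x j \<in> borel_measurable (F k)"
proof (induction j rule: less_induct)
  case (less j)
  consider "j \<le> 1" | m where "j = Suc (Suc m)" by (metis One_nat_def le_Suc_eq le_zero_eq not0_implies_Suc)
  then show ?case
  proof cases
    case 1
    then have "x j \<omega> = x0" if "\<omega> \<in> space (F k)" for \<omega>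
      using init that by (cases j) auto
    then show ?thesis by (subst measurable_cong) (assumption, simp)
  next
    case (2 m)
    have [measurable]: "x (Suc m) \<in> borel_measurable (F k)" "x m \<in> borel_measurable (F k)"
      "\<xi> (Suc m) \<in> measurable (F k) N"
      using less 2 noise_past by auto
    have [measurable]: "G (Suc m) \<in> borel_measurable (F k)"
      using measurable_compose[OF measurable_Pair oracle_measurable, of "x (Suc m)" "F k" "\<xi> (Suc m)"]
      by simp
    have "x j \<omega> = x (Suc m) \<omega> + (real (Suc m) / (real (Suc m) + 2)) *\<^sub>R (x (Suc m) \<omega> - x m \<omega>)
        - (\<alpha> (Suc m) / (real (Suc m) + 2)) *\<^sub>R G (Suc m) \<omega>" if "\<omega> \<in> space (F k)" for \<omega>
      using step[of "Suc m" \<omega>] that 2 by simp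
    then show ?thesis by (subst measurable_cong) (assumption, measurable)
  qed
qed

lemma iterate_measurable [measurable]: "x k \<in> borel_measurable M"
  using iterate_past[of k k] past_subalgebra by (blast intro: measurable_from_subalg)

lemma oracle_output_measurable [measurable]: "k \<ge> 1 \<Longrightarrow> G k \<in> borel_measurable M"
  using measurable_compose[OF measurable_Pair oracle_measurable, of "x k" M "\<xi> k"] noise_measurable[of k]
  by simp

lemma past_sigma_finite_subalgebra: "sigma_finite_subalgebra M (F k)"
proof -
  interpret finite_measure_subalgebra M "F k"
    by unfold_locales (rule past_subalgebra)
  show ?thesis by unfold_locales
qed

lemma gap_nonneg: "0 \<le> gap y"
  using minimizer by (simp add: gap_def)

lemma gap_le: "gap y \<le> L / 2 * (norm (y - xstar))\<^sup>2"
  using L_smooth_upper_bound[OF smooth, of y xstar] gradient_minimizer_eq_0[OF smooth minimizer]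
  by (simp add: gap_def)

lemma gap_measurable [measurable]: "gap \<in> borel_measurable borel"
  using L_smooth_borel_measurable(1)[OF smooth] unfolding gap_def[abs_def] by measurable

lemma gradient_measurable [measurable]: "gradient f \<in> borel_measurable borel"
  by (rule L_smooth_borel_measurable(2)[OF smooth])

lemma gradient_norm_le: "norm (gradient f y) \<le> L * norm (y - xstar)"
  using smooth gradient_minimizer_eq_0[OF smooth minimizer] unfolding L_smooth_def
  by (metis diff_zero)

lemma gradient_square_integrable:
  assumes "square_integrable M X"
  shows "square_integrable M (\<lambda>\<omega>. gradient f (X \<omega>))"
proof (rule square_integrable_bound)
  show "square_integrable M (\<lambda>\<omega>. X \<omega> - xstar)"
    by (intro square_integrable_diff assms square_integrable_const finite_measure_axioms)
  show "(\<lambda>\<omega>. gradient f (X \<omega>)) \<in> borel_measurable M"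
    using assms by (auto simp: square_integrable_def)
qed (rule gradient_norm_le)

lemma gap_integrable:
  assumes "square_integrable M X"
  shows "integrable M (\<lambda>\<omega>. gap (X \<omega>))"
proof (rule Bochner_Integration.integrable_bound)
  have "square_integrable M (\<lambda>\<omega>. X \<omega> - xstar)"
    by (intro square_integrable_diff assms square_integrable_const finite_measure_axioms)
  then show "integrable M (\<lambda>\<omega>. L / 2 * (norm (X \<omega> - xstar))\<^sup>2)"
    by (simp add: square_integrable_def)
  show "(\<lambda>\<omega>. gap (X \<omega>)) \<in> borel_measurable M"
    using assms by (auto simp: square_integrable_def)
  show "AE \<omega> in M. norm (gap (X \<omega>)) \<le> norm (L / 2 * (norm (X \<omega> - xstar))\<^sup>2)"
    using gap_le gap_nonneg L_pos by simp
qed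

text \<open>
  The hypotheses on the oracle do not mention integrability of its output; it follows from the
  conditional second moment bound once the query point is square-integrable. This in turn
  carries square-integrability to the next iterate.
\<close>

lemma oracle_second_moment:
  assumes k: "k \<ge> 1" and X: "square_integrable M (x k)"
  shows "square_integrable M (G k)"
    and "A \<in> sets (F k) \<Longrightarrow> (\<integral>\<omega>. indicator A \<omega> * (norm (G k \<omega>))\<^sup>2 \<partial>M)
      \<le> (\<integral>\<omega>. indicator A \<omega> * ((norm (gradient f (x k \<omega>)))\<^sup>2 + \<sigma>\<^sup>2) \<partial>M)"
proof -
  interpret cond: sigma_finite_subalgebra M "F k" by (rule past_sigma_finite_subalgebra)
  have [measurable]: "G k \<in> borel_measurable M" by (rule oracle_output_measurable[OF k])
  have "integrable M (\<lambda>\<omega>. (norm (gradient f (x k \<omega>)))\<^sup>2 + \<sigma>\<^sup>2)"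
    using gradient_square_integrable[OF X] by (simp add: square_integrable_def)
  note bound = cond.integral_le_of_nn_cond_exp_le[OF _ _ this _ second_moment[OF k]]
  show "square_integrable M (G k)"
    unfolding square_integrable_def by (auto intro!: bound(1))
  show "A \<in> sets (F k) \<Longrightarrow> (\<integral>\<omega>. indicator A \<omega> * (norm (G k \<omega>))\<^sup>2 \<partial>M)
      \<le> (\<integral>\<omega>. indicator A \<omega> * ((norm (gradient f (x k \<omega>)))\<^sup>2 + \<sigma>\<^sup>2) \<partial>M)"
    by (intro bound(2)) auto
qed

lemma iterate_square_integrable: "square_integrable M (x k)"
proof (induction k rule: less_induct)
  case (less k)
  consider "k \<le> 1" | m where "k = Suc (Suc m)" by (metis One_nat_def le_Suc_eq le_zero_eq not0_implies_Suc)
  then show ?case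
  proof cases
    case 1
    then have "x0 = x k \<omega>" if "\<omega> \<in> space M" for \<omega>
      using init that by (cases k) auto
    then show ?thesis
      by (rule square_integrable_cong[OF square_integrable_const[OF finite_measure_axioms]])
  next
    case (2 m)
    have X: "square_integrable M (x (Suc m))" "square_integrable M (x m)"
      using less 2 by auto
    have "square_integrable M (\<lambda>\<omega>. x (Suc m) \<omega> + (real (Suc m) / (real (Suc m) + 2)) *\<^sub>R (x (Suc m) \<omega> - x m \<omega>)
        - (\<alpha> (Suc m) / (real (Suc m) + 2)) *\<^sub>R G (Suc m) \<omega>)"
      by (intro square_integrable_diff square_integrable_add square_integrable_scaleR X
          oracle_second_moment(1)) simp
    then show ?thesis
      by (rule square_integrable_cong) (use step[of "Suc m"] 2 in simp)
  qed
qed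

lemma z_past: "z k \<in> borel_measurable (F (Suc k))"
  unfolding z_def[abs_def] using iterate_past[of "Suc k" "Suc k"] iterate_past[of k "Suc k"] by simp

lemma z_square_integrable: "square_integrable M (z k)"
  unfolding z_def[abs_def]
  by (intro square_integrable_add square_integrable_scaleR square_integrable_diff iterate_square_integrable)

text \<open>
  The factor \<open>k + 2\<close> in the denominators of the recursion is what makes the momentum terms cancel,
  so that \<open>z\<close> performs plain stochastic gradient descent.
\<close>

lemma z_Suc:
  assumes "\<omega> \<in> space M"
  shows "z (Suc k) \<omega> = z k \<omega> - \<alpha> (Suc k) *\<^sub>R G (Suc k) \<omega>"
proof -
  define d where "d = x (Suc (Suc k)) \<omega> - x (Suc k) \<omega>"
  have d: "d = ((real k + 1) / (real k + 3)) *\<^sub>R (x (Suc k) \<omega> - x k \<omega>)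
      - (\<alpha> (Suc k) / (real k + 3)) *\<^sub>R G (Suc k) \<omega>"
    using step[of "Suc k" \<omega>] assms unfolding d_def by (simp add: add_ac)
  have "real k + 3 \<noteq> 0" by linarith
  then have "(real k + 3) *\<^sub>R d
      = (real k + 1) *\<^sub>R (x (Suc k) \<omega> - x k \<omega>) - \<alpha> (Suc k) *\<^sub>R G (Suc k) \<omega>"
    unfolding d scaleR_diff_right[of "real k + 3"] scaleR_scaleR by simp
  moreover have "z (Suc k) \<omega> = x (Suc k) \<omega> + (real k + 3) *\<^sub>R d"
  proof -
    have "z (Suc k) \<omega> = x (Suc k) \<omega> + d + (real k + 2) *\<^sub>R d"
      by (simp add: z_def d_def add_ac)
    also have "d + (real k + 2) *\<^sub>R d = (1 + (real k + 2)) *\<^sub>R d"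
      by (simp only: scaleR_left_distrib scaleR_one)
    then have "x (Suc k) \<omega> + d + (real k + 2) *\<^sub>R d = x (Suc k) \<omega> + (real k + 3) *\<^sub>R d"
      by (simp add: add.assoc)
    finally show ?thesis .
  qed
  ultimately show ?thesis by (simp add: z_def)
qed

text \<open>
  With \<open>u\<close> the current and \<open>v\<close> the previous iterate, the vector \<open>u + c *\<^sub>R (u - v) - xstar\<close> is the
  displacement of \<open>z\<close>. The part \<open>u - xstar\<close> yields the gap at \<open>u\<close> and a squared gradient norm that
  covers \<open>a\<^sup>2\<close> times itself; the tangent inequality turns the part \<open>u - v\<close> into a difference of gaps.
\<close>

lemma gradient_step_decrease:
  assumes "0 \<le> a" "L * a \<le> 1" "0 \<le> c"
  shows "2 * a * ((c + 1) * gap u - c * gap v) + a\<^sup>2 * (norm (gradient f u))\<^sup>2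
    \<le> 2 * a * (gradient f u \<bullet> (u + c *\<^sub>R (u - v) - xstar))"
proof -
  have "a\<^sup>2 * (norm (gradient f u))\<^sup>2 \<le> a / L * (norm (gradient f u))\<^sup>2"
  proof (rule mult_right_mono)
    have "a * (L * a) \<le> a * 1" using assms by (intro mult_left_mono) auto
    then show "a\<^sup>2 \<le> a / L" using L_pos by (simp add: field_simps power2_eq_square)
  qed simp
  moreover have "a / L * (norm (gradient f u))\<^sup>2 = 2 * a * ((norm (gradient f u))\<^sup>2 / (2 * L))"
    by simp
  moreover have "2 * a * ((norm (gradient f u))\<^sup>2 / (2 * L)) + 2 * a * ((c + 1) * gap u - c * gap v)
    \<le> 2 * a * (gradient f u \<bullet> (u + c *\<^sub>R (u - v) - xstar))"
    unfolding distrib_left[symmetric]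
  proof (rule mult_left_mono)
    have "c * (gap u - gap v) \<le> c * (gradient f u \<bullet> (u - v))"
      using convex_tangent_below[OF smooth convex, of u v] assms
      by (intro mult_left_mono) (auto simp: gap_def inner_diff_right)
    moreover have "gap u + (norm (gradient f u))\<^sup>2 / (2 * L) \<le> gradient f u \<bullet> (u - xstar)"
      using gradient_toward_minimizer[OF smooth convex L_pos minimizer, of u] by (simp add: gap_def)
    moreover have "gradient f u \<bullet> (u + c *\<^sub>R (u - v) - xstar)
        = gradient f u \<bullet> (u - xstar) + c * (gradient f u \<bullet> (u - v))"
      by (simp add: inner_simps algebra_simps)
    ultimately show "(norm (gradient f u))\<^sup>2 / (2 * L) + ((c + 1) * gap u - c * gap v)
      \<le> gradient f u \<bullet> (u + c *\<^sub>R (u - v) - xstar)" by (simp add: algebra_simps)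
  qed (use assms in simp)
  ultimately show ?thesis by linarith
qed

lemma energy_nonneg: "k \<ge> 1 \<Longrightarrow> 0 \<le> energy k \<omega>"
  using gap_nonneg[of "x k \<omega>"] step_pos[of k] by (simp add: energy_def)

lemma energy_past: "energy k \<in> borel_measurable (F (Suc k))"
proof -
  have [measurable]: "z k \<in> borel_measurable (F (Suc k))" "x k \<in> borel_measurable (F (Suc k))"
    using z_past iterate_past by simp_all
  show ?thesis unfolding energy_def[abs_def] by measurable
qed

lemma energy_integrable: "integrable M (energy k)"
  using square_integrable_diff[OF z_square_integrable[of k] square_integrable_const[OF finite_measure_axioms, of xstar]]
    gap_integrable[OF iterate_square_integrable[of k]]
  unfolding energy_def[abs_def] square_integrable_def by simp

text \<open>
  The supermartingale inequality, integrated over an arbitrary event of the past. The inner product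
  and the squared norm of the oracle output are replaced by what is known about their conditional
  expectations, after which the estimate is pointwise.
\<close>

lemma energy_decrease:
  assumes k: "k \<ge> 1" and small: "L * \<alpha> (Suc k) \<le> 1" and A: "A \<in> sets (F (Suc k))"
  shows "(\<integral>\<omega>. indicator A \<omega> * energy (Suc k) \<omega> \<partial>M)
    \<le> (\<integral>\<omega>. indicator A \<omega> * (energy k \<omega> - \<alpha> (Suc k) * gap (x k \<omega>) + \<sigma>\<^sup>2 * (\<alpha> (Suc k))\<^sup>2) \<partial>M)"
proof -
  interpret cond: sigma_finite_subalgebra M "F (Suc k)" by (rule past_sigma_finite_subalgebra)
  define a where "a = \<alpha> (Suc k)"
  define W where "W \<omega> = indicat_real A \<omega> *\<^sub>R (z k \<omega> - xstar)" for \<omega>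
  define P where "P \<omega> = indicat_real A \<omega> *
      ((norm (z k \<omega> - xstar))\<^sup>2 + 2 * a * (real k + 2) * gap (x (Suc k) \<omega>))" for \<omega>
  define D where "D \<omega> = gradient f (x (Suc k) \<omega>)" for \<omega>
  have a: "a > 0" using step_pos[of "Suc k"] by (simp add: a_def)
  have A_M: "A \<in> sets M" using A past_subalgebra by (auto simp: subalgebra_def)
  note int_A = integrable_mult_indicator[OF A_M, where 'b=real, simplified]
  have zc: "square_integrable M (\<lambda>\<omega>. z k \<omega> - xstar)"
    by (intro square_integrable_diff z_square_integrable square_integrable_const finite_measure_axioms)
  have W_F: "W \<in> borel_measurable (F (Suc k))"
    unfolding W_def[abs_def] using A z_past[of k] by measurable
  have W: "square_integrable M W"
    by (rule square_integrable_bound[OF zc, where c = 1])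
      (use W_F past_subalgebra in \<open>auto simp: W_def intro: measurable_from_subalg split: split_indicator\<close>)
  note X = iterate_square_integrable[of "Suc k"]
  have G: "square_integrable M (G (Suc k))"
    using oracle_second_moment(1)[OF _ X] by simp
  have D: "square_integrable M D"
    unfolding D_def[abs_def] by (rule gradient_square_integrable[OF X])
  have P: "integrable M P"
    unfolding P_def[abs_def] using zc gap_integrable[OF X]
    by (intro int_A) (simp add: square_integrable_def)
  have GA: "integrable M (\<lambda>\<omega>. indicat_real A \<omega> * (norm (G (Suc k) \<omega>))\<^sup>2)"
    using G by (intro int_A) (simp add: square_integrable_def)
  have DA: "integrable M (\<lambda>\<omega>. indicat_real A \<omega> * ((norm (D \<omega>))\<^sup>2 + \<sigma>\<^sup>2))"
    using D by (intro int_A) (simp add: square_integrable_def)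
  note GW = square_integrable_inner[OF G W] and DW = square_integrable_inner[OF D W]
  \<comment> \<open>\<open>P\<close> collects what the past determines, \<open>W\<close> is the weight against which the output is tested\<close>
  have "(\<integral>\<omega>. indicator A \<omega> * energy (Suc k) \<omega> \<partial>M)
      = (\<integral>\<omega>. P \<omega> - 2 * a * (G (Suc k) \<omega> \<bullet> W \<omega>)
          + a\<^sup>2 * (indicat_real A \<omega> * (norm (G (Suc k) \<omega>))\<^sup>2) \<partial>M)"
  proof (rule Bochner_Integration.integral_cong)
    fix \<omega> assume "\<omega> \<in> space M"
    then have "z (Suc k) \<omega> - xstar = (z k \<omega> - xstar) - a *\<^sub>R G (Suc k) \<omega>"
      by (simp add: z_Suc a_def)
    moreover have "(norm ((z k \<omega> - xstar) - a *\<^sub>R G (Suc k) \<omega>))\<^sup>2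
        = (norm (z k \<omega> - xstar))\<^sup>2 - 2 * a * (G (Suc k) \<omega> \<bullet> (z k \<omega> - xstar)) + a\<^sup>2 * (norm (G (Suc k) \<omega>))\<^sup>2"
      using dot_norm_neg[of "z k \<omega> - xstar" "a *\<^sub>R G (Suc k) \<omega>"]
      by (simp add: inner_commute power_mult_distrib)
    ultimately have "(norm (z (Suc k) \<omega> - xstar))\<^sup>2
        = (norm (z k \<omega> - xstar))\<^sup>2 - 2 * a * (G (Suc k) \<omega> \<bullet> (z k \<omega> - xstar)) + a\<^sup>2 * (norm (G (Suc k) \<omega>))\<^sup>2"
      by (simp only:)
    then show "indicator A \<omega> * energy (Suc k) \<omega> = P \<omega> - 2 * a * (G (Suc k) \<omega> \<bullet> W \<omega>)
          + a\<^sup>2 * (indicat_real A \<omega> * (norm (G (Suc k) \<omega>))\<^sup>2)"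
      by (simp add: energy_def P_def W_def a_def add_ac split: split_indicator)
  qed simp
  also have "\<dots> = (\<integral>\<omega>. P \<omega> \<partial>M) - 2 * a * (\<integral>\<omega>. G (Suc k) \<omega> \<bullet> W \<omega> \<partial>M)
      + a\<^sup>2 * (\<integral>\<omega>. indicat_real A \<omega> * (norm (G (Suc k) \<omega>))\<^sup>2 \<partial>M)"
    using P GA GW by simp
  also have "\<dots> \<le> (\<integral>\<omega>. P \<omega> \<partial>M) - 2 * a * (\<integral>\<omega>. D \<omega> \<bullet> W \<omega> \<partial>M)
      + a\<^sup>2 * (\<integral>\<omega>. indicat_real A \<omega> * ((norm (D \<omega>))\<^sup>2 + \<sigma>\<^sup>2) \<partial>M)"
  proof -
    have "(\<integral>\<omega>. G (Suc k) \<omega> \<bullet> W \<omega> \<partial>M) = (\<integral>\<omega>. D \<omega> \<bullet> W \<omega> \<partial>M)"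
      using D unbiased[of "Suc k"]
      by (intro cond.integral_inner_vec_cond_exp[OF W W_F G]) (auto simp: D_def square_integrable_def)
    moreover have "a\<^sup>2 * (\<integral>\<omega>. indicat_real A \<omega> * (norm (G (Suc k) \<omega>))\<^sup>2 \<partial>M)
        \<le> a\<^sup>2 * (\<integral>\<omega>. indicat_real A \<omega> * ((norm (D \<omega>))\<^sup>2 + \<sigma>\<^sup>2) \<partial>M)"
      using oracle_second_moment(2)[OF _ X A] by (intro mult_left_mono) (auto simp: D_def)
    ultimately show ?thesis by simp
  qed
  also have "\<dots> = (\<integral>\<omega>. P \<omega> - 2 * a * (D \<omega> \<bullet> W \<omega>)
      + a\<^sup>2 * (indicat_real A \<omega> * ((norm (D \<omega>))\<^sup>2 + \<sigma>\<^sup>2)) \<partial>M)"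
    using P DA DW by simp
  also have "\<dots> \<le> (\<integral>\<omega>. indicator A \<omega> * (energy k \<omega> - a * gap (x k \<omega>) + \<sigma>\<^sup>2 * a\<^sup>2) \<partial>M)"
  proof (rule integral_mono)
    show "integrable M (\<lambda>\<omega>. P \<omega> - 2 * a * (D \<omega> \<bullet> W \<omega>)
        + a\<^sup>2 * (indicat_real A \<omega> * ((norm (D \<omega>))\<^sup>2 + \<sigma>\<^sup>2)))"
      using P DA DW by simp
    show "integrable M (\<lambda>\<omega>. indicat_real A \<omega> * (energy k \<omega> - a * gap (x k \<omega>) + \<sigma>\<^sup>2 * a\<^sup>2))"
      using energy_integrable[of k] gap_integrable[OF iterate_square_integrable[of k]]
      by (intro int_A) simp
    fix \<omega> assume "\<omega> \<in> space M"
    have "2 * a * ((real k + 1 + 1) * gap (x (Suc k) \<omega>) - (real k + 1) * gap (x k \<omega>)) + a\<^sup>2 * (norm (D \<omega>))\<^sup>2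
        \<le> 2 * a * (D \<omega> \<bullet> (z k \<omega> - xstar))"
      using gradient_step_decrease[of a "real k + 1" "x (Suc k) \<omega>" "x k \<omega>"] a small
      by (simp add: z_def D_def a_def)
    moreover have "a * gap (x k \<omega>) \<le> 2 * (real k + 1) * (\<alpha> k - a) * gap (x k \<omega>)"
      using step_decay[OF k] gap_nonneg[of "x k \<omega>"] by (intro mult_right_mono) (auto simp: a_def)
    ultimately have "(norm (z k \<omega> - xstar))\<^sup>2 + 2 * a * (real k + 2) * gap (x (Suc k) \<omega>)
        - 2 * a * (D \<omega> \<bullet> (z k \<omega> - xstar)) + a\<^sup>2 * ((norm (D \<omega>))\<^sup>2 + \<sigma>\<^sup>2)
        \<le> energy k \<omega> - a * gap (x k \<omega>) + \<sigma>\<^sup>2 * a\<^sup>2"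
      by (simp add: energy_def algebra_simps)
    then show "P \<omega> - 2 * a * (D \<omega> \<bullet> W \<omega>) + a\<^sup>2 * (indicat_real A \<omega> * ((norm (D \<omega>))\<^sup>2 + \<sigma>\<^sup>2))
        \<le> indicat_real A \<omega> * (energy k \<omega> - a * gap (x k \<omega>) + \<sigma>\<^sup>2 * a\<^sup>2)"
      by (simp add: P_def W_def split: split_indicator)
  qed
  finally show ?thesis by (simp add: a_def)
qed

text \<open>
  A bound on the energy alone would give only the first claim. Carrying the accumulated decreases
  along in the same supermartingale bounds the partial sums of the second as well.
\<close>

lemma gap_rates:
  "AE \<omega> in M. (\<exists>B. \<forall>\<^sub>F k in sequentially. \<alpha> k * (real k + 1) * gap (x k \<omega>) \<le> B) \<and>
    summable (\<lambda>k. \<alpha> (Suc k) * gap (x k \<omega>))"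
proof -
  obtain p where p: "p \<ge> 1" "\<And>k. k \<ge> p \<Longrightarrow> L * \<alpha> k \<le> 1"
    using step_small unfolding eventually_sequentially by (metis le_trans nat_le_linear)
  \<comment> \<open>the variance of all steps from \<open>k\<close> on, a budget that the noise uses up one term at a time\<close>
  define T where "T k = \<sigma>\<^sup>2 * (\<Sum>j. (\<alpha> (j + k))\<^sup>2)" for k
  have T_Suc: "T k = \<sigma>\<^sup>2 * (\<alpha> k)\<^sup>2 + T (Suc k)" for k
    using suminf_split_head[of "\<lambda>j. (\<alpha> (j + k))\<^sup>2"] summable_ignore_initial_segment[OF step_square_summable, of k]
    by (simp add: T_def distrib_left[symmetric])
  have T_nonneg: "0 \<le> T k" for k
    unfolding T_def using summable_ignore_initial_segment[OF step_square_summable, of k]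
    by (intro mult_nonneg_nonneg suminf_nonneg) auto
  define S where "S n \<omega> = energy (n + p) \<omega> + (\<Sum>j<n. \<alpha> (Suc (j + p)) * gap (x (j + p) \<omega>))
      + T (Suc (n + p))" for n \<omega>
  have term_nonneg: "0 \<le> \<alpha> (Suc j) * gap (x j \<omega>)" for j \<omega>
    using step_pos[of "Suc j"] gap_nonneg[of "x j \<omega>"] by simp
  have S_int: "integrable M (S n)" for n
    unfolding S_def[abs_def] using energy_integrable gap_integrable[OF iterate_square_integrable] by simp
  have "AE \<omega> in M. \<exists>B. \<forall>n. S n \<omega> \<le> B"
  proof (rule nonneg_supermartingale_AE_bounded)
    show "subalgebra M (F (Suc (n + p)))" for n by (rule past_subalgebra)
    show "sets (F (Suc (m + p))) \<subseteq> sets (F (Suc (n + p)))" if "m \<le> n" for m n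
      using that by (intro past_mono) simp
    show "S n \<in> borel_measurable (F (Suc (n + p)))" for n
    proof -
      have "(\<lambda>\<omega>. gap (x (j + p) \<omega>)) \<in> borel_measurable (F (Suc (n + p)))" if "j < n" for j
        using iterate_past[of "j + p" "Suc (n + p)"] that by simp
      then show ?thesis unfolding S_def[abs_def] using energy_past[of "n + p"] by simp
    qed
    show "integrable M (S n)" for n by (rule S_int)
    show "0 \<le> S n \<omega>" for n \<omega>
      unfolding S_def using p(1) by (intro add_nonneg_nonneg sum_nonneg term_nonneg T_nonneg energy_nonneg) simp
    fix n A assume A: "A \<in> sets (F (Suc (n + p)))"
    then have A_M: "A \<in> sets M" using past_subalgebra by (auto simp: subalgebra_def)
    note int_A = integrable_mult_indicator[OF A_M, where 'b=real, simplified]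
    let ?R = "\<lambda>\<omega>. (\<Sum>j<Suc n. \<alpha> (Suc (j + p)) * gap (x (j + p) \<omega>)) + T (Suc (Suc n + p))"
    let ?E = "\<lambda>\<omega>. energy (n + p) \<omega> - \<alpha> (Suc (n + p)) * gap (x (n + p) \<omega>) + \<sigma>\<^sup>2 * (\<alpha> (Suc (n + p)))\<^sup>2"
    have R: "integrable M (\<lambda>\<omega>. indicat_real A \<omega> * ?R \<omega>)"
      using gap_integrable[OF iterate_square_integrable] by (intro int_A) simp
    have E: "integrable M (\<lambda>\<omega>. indicat_real A \<omega> * ?E \<omega>)"
      using gap_integrable[OF iterate_square_integrable] energy_integrable by (intro int_A) simp
    have E': "integrable M (\<lambda>\<omega>. indicat_real A \<omega> * energy (Suc n + p) \<omega>)"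
      by (intro int_A energy_integrable)
    have "(\<integral>\<omega>. indicator A \<omega> * S (Suc n) \<omega> \<partial>M)
        = (\<integral>\<omega>. indicator A \<omega> * energy (Suc n + p) \<omega> + indicator A \<omega> * ?R \<omega> \<partial>M)"
      by (intro Bochner_Integration.integral_cong) (auto simp: S_def algebra_simps)
    also have "\<dots> = (\<integral>\<omega>. indicator A \<omega> * energy (Suc n + p) \<omega> \<partial>M) + (\<integral>\<omega>. indicator A \<omega> * ?R \<omega> \<partial>M)"
      by (rule Bochner_Integration.integral_add[OF E' R])
    also have "\<dots> \<le> (\<integral>\<omega>. indicator A \<omega> * ?E \<omega> \<partial>M) + (\<integral>\<omega>. indicator A \<omega> * ?R \<omega> \<partial>M)"
      using energy_decrease[of "n + p" A] p A by simp
    also have "\<dots> = (\<integral>\<omega>. indicator A \<omega> * ?E \<omega> + indicator A \<omega> * ?R \<omega> \<partial>M)"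
      by (rule Bochner_Integration.integral_add[OF E R, symmetric])
    also have "\<dots> = (\<integral>\<omega>. indicator A \<omega> * S n \<omega> \<partial>M)"
      by (intro Bochner_Integration.integral_cong)
        (auto simp: S_def T_Suc[of "Suc (n + p)"] split: split_indicator)
    finally show "(\<integral>\<omega>. indicator A \<omega> * S (Suc n) \<omega> \<partial>M) \<le> (\<integral>\<omega>. indicator A \<omega> * S n \<omega> \<partial>M)" .
  qed
  then show ?thesis
  proof (rule AE_mp, intro AE_I2 impI)
    fix \<omega> assume "\<exists>B. \<forall>n. S n \<omega> \<le> B"
    then obtain B where B: "\<And>n. S n \<omega> \<le> B" by blast
    have parts: "energy (n + p) \<omega> \<le> B" "(\<Sum>j<n. \<alpha> (Suc (j + p)) * gap (x (j + p) \<omega>)) \<le> B" for n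
      using B[of n] T_nonneg[of "Suc (n + p)"] energy_nonneg[of "n + p" \<omega>] p(1)
        sum_nonneg[of "{..<n}" "\<lambda>j. \<alpha> (Suc (j + p)) * gap (x (j + p) \<omega>)"] term_nonneg
      by (simp_all add: S_def)
    have "\<alpha> k * (real k + 1) * gap (x k \<omega>) \<le> B" if "k \<ge> p" for k
    proof -
      have "2 * (\<alpha> k * (real k + 1) * gap (x k \<omega>)) \<le> B"
      proof -
        have "energy k \<omega> \<le> B" using parts(1)[of "k - p"] that by simp
        moreover have "0 \<le> (norm (z k \<omega> - xstar))\<^sup>2" by simp
        moreover have "2 * (\<alpha> k * (real k + 1) * gap (x k \<omega>)) = 2 * \<alpha> k * (real k + 1) * gap (x k \<omega>)"
          by simp
        ultimately show ?thesis unfolding energy_def by linarith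
      qed
      moreover have "0 \<le> \<alpha> k * (real k + 1) * gap (x k \<omega>)"
        using step_pos[of k] gap_nonneg that p(1) by simp
      ultimately show ?thesis by linarith
    qed
    then have "\<forall>\<^sub>F k in sequentially. \<alpha> k * (real k + 1) * gap (x k \<omega>) \<le> B"
      by (rule eventually_sequentiallyI)
    moreover have "summable (\<lambda>j. \<alpha> (Suc (j + p)) * gap (x (j + p) \<omega>))"
      using term_nonneg parts(2) by (intro bounded_imp_summable[where B = B])
        (auto simp: lessThan_Suc_atMost[symmetric] simp del: sum.lessThan_Suc)
    then have "summable (\<lambda>k. \<alpha> (Suc k) * gap (x k \<omega>))"
      by (subst (asm) summable_iff_shift)
    ultimately show "(\<exists>B. \<forall>\<^sub>F k in sequentially. \<alpha> k * (real k + 1) * gap (x k \<omega>) \<le> B) \<and>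
        summable (\<lambda>k. \<alpha> (Suc k) * gap (x k \<omega>))" by blast
  qed
qed

end

section \<open>The logarithmic step sizes\<close>

lemma sqrt_stepsize:
  assumes "L > 0"
  shows "sqrt (stepsize L k) = 1 / (L * ln (real k + 2))"
  using assms ln_ge_zero[of "real k + 2"]
  by (simp add: stepsize_def real_sqrt_divide real_sqrt_mult)

text \<open>
  Comparison with the telescoping differences of \<open>1 / ln (k + 2)\<close>.
\<close>

lemma summable_inverse_k_ln_squared: "summable (\<lambda>k. 1 / (real k * (ln (real k + 2))\<^sup>2))"
proof (rule summable_comparison_test_bigo)
  have "(\<lambda>k. 1 / ln (real k + 2)) \<longlonglongrightarrow> 0" by real_asymp
  from telescope_summable'[OF this]
  show "summable (\<lambda>k. norm (1 / ln (real k + 2) - 1 / ln (real (Suc k) + 2)))"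
  proof (rule summable_cong[THEN iffD1, rotated])
    have "1 / ln (real (Suc k) + 2) \<le> 1 / ln (real k + 2)" for k
      by (intro divide_left_mono mult_pos_pos) auto
    then show "\<forall>\<^sub>F k in sequentially. 1 / ln (real k + 2) - 1 / ln (real (Suc k) + 2)
        = norm (1 / ln (real k + 2) - 1 / ln (real (Suc k) + 2))"
      by (intro always_eventually allI) (metis abs_of_nonneg diff_ge_0_iff_ge real_norm_def)
  qed
  show "(\<lambda>k. 1 / (real k * (ln (real k + 2))\<^sup>2))
      \<in> O(\<lambda>k. 1 / ln (real k + 2) - 1 / ln (real (Suc k) + 2))"
    by real_asymp
qed

text \<open>
  The terms have the order \<open>1 / (k ln k ln (ln k))\<close> of the derivative of \<open>ln (ln (ln k))\<close>, whose
  differences telescope to infinity. They are kept in the form in which the step size at \<open>k + 1\<close> and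
  the claimed rate at \<open>k\<close> enter. At \<open>k = 0\<close> the square root in the denominator vanishes, so the term
  is 0.
\<close>

lemma not_summable_inverse_k_ln_lnln:
  "\<not> summable (\<lambda>k. 1 / (sqrt (real (k+1)) * ln (real (k+1) + 2) * (sqrt (real k) * ln (ln (real k + 2)))))"
  (is "\<not> summable ?h")
proof
  assume sum: "summable ?h"
  let ?F = "\<lambda>k. ln (ln (ln (real k)))"
  have "summable (\<lambda>k. ?F (Suc k) - ?F k)"
  proof (rule summable_comparison_test_bigo)
    have "?h k \<ge> 0" for k
    proof (cases k)
      case (Suc m)
      have "1 \<le> ln (real k + 2)"
        using exp_le Suc by (subst ln_ge_iff) auto
      then show ?thesis by simp
    qed simp
    then show "summable (\<lambda>k. norm (?h k))" using sum by simp
    show "(\<lambda>k. ?F (Suc k) - ?F k) \<in> O(?h)" by real_asymp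
  qed
  then have "convergent (\<lambda>n. \<Sum>k<n. ?F (Suc k) - ?F k)" by (simp add: summable_iff_convergent)
  then have "convergent (\<lambda>n. ?F n - ?F 0)" unfolding sum_lessThan_telescope[of ?F] .
  moreover have "filterlim (\<lambda>n. ?F n - ?F 0) at_top sequentially" by real_asymp
  ultimately show False
    using not_tendsto_and_filterlim_at_infinity[OF sequentially_bot _ filterlim_at_top_imp_at_infinity]
    unfolding convergent_def by blast
qed

lemma momentum_stepsize_eq:
  assumes "L > 0"
  shows "2 * sqrt (stepsize L k) / sqrt (real k) = 2 / L * (1 / (sqrt (real k) * ln (real k + 2)))"
  using assms by (simp add: sqrt_stepsize)

text \<open>
  The logarithm only helps, so the claim reduces to \<open>(2k + 3) / \<surd>(k + 1) \<le> (2k + 2) / \<surd>k\<close>,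
  which after squaring is a polynomial inequality.
\<close>

lemma momentum_stepsize_decay:
  assumes L: "L > 0" and k: "k \<ge> 1"
  defines "\<alpha> \<equiv> \<lambda>k. 2 * sqrt (stepsize L k) / sqrt (real k)"
  shows "\<alpha> (Suc k) \<le> 2 * (real k + 1) * (\<alpha> k - \<alpha> (Suc k))"
proof -
  define n where "n = real k"
  have n: "n \<ge> 1" using k by (simp add: n_def)
  have "(2 * n + 3) * sqrt n \<le> (2 * n + 2) * sqrt (n + 1)"
  proof (rule power2_le_imp_le)
    have "n * (2 * n + 3)\<^sup>2 \<le> (n + 1) * (2 * n + 2)\<^sup>2"
      using n by (simp add: power2_eq_square algebra_simps)
    then show "((2 * n + 3) * sqrt n)\<^sup>2 \<le> ((2 * n + 2) * sqrt (n + 1))\<^sup>2"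
      using n by (simp add: power_mult_distrib mult.commute)
  qed (use n in simp)
  then have root: "(2 * n + 3) / sqrt (n + 1) \<le> (2 * n + 2) / sqrt n"
    using n by (simp add: field_simps)
  have "(2 * n + 3) * (1 / (sqrt (n + 1) * ln (n + 3))) = (2 * n + 3) / sqrt (n + 1) * (1 / ln (n + 3))"
    by simp
  also have "\<dots> \<le> (2 * n + 2) / sqrt n * (1 / ln (n + 2))"
    using n root by (intro mult_mono) (auto intro!: divide_left_mono mult_pos_pos)
  also have "\<dots> = (2 * n + 2) * (1 / (sqrt n * ln (n + 2)))" by simp
  finally have "2 / L * ((2 * n + 3) * (1 / (sqrt (n + 1) * ln (n + 3))))
      \<le> 2 / L * ((2 * n + 2) * (1 / (sqrt n * ln (n + 2))))"
    using L by (intro mult_left_mono) auto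
  moreover have "\<alpha> k = 2 / L * (1 / (sqrt n * ln (n + 2)))"
    "\<alpha> (Suc k) = 2 / L * (1 / (sqrt (n + 1) * ln (n + 3)))"
    unfolding \<alpha>_def momentum_stepsize_eq[OF L] by (simp_all add: n_def add_ac)
  ultimately have "(2 * n + 3) * \<alpha> (Suc k) \<le> (2 * n + 2) * \<alpha> k"
    by (simp only: mult.left_commute[of "2 / L"])
  then show ?thesis unfolding n_def[symmetric] by (simp add: algebra_simps)
qed

section \<open>Almost sure rates\<close>

theorem theorem4:
  fixes f :: "real ^ 'n \<Rightarrow> real"
    and L \<sigma> :: real
    and x0 xstar :: "real ^ 'n"
    and M :: "'w measure"
    and N :: "'x measure"
    and \<xi> :: "nat \<Rightarrow> 'w \<Rightarrow> 'x"
    and g :: "real ^ 'n \<Rightarrow> 'x \<Rightarrow> real ^ 'n"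
    and x :: "nat \<Rightarrow> 'w \<Rightarrow> real ^ 'n"
    and r :: "nat \<Rightarrow> real"
  assumes "prob_space M"
    and "L > 0" and "\<sigma> \<ge> 0"
    and convex: "convex_on UNIV f"
    and smooth: "L_smooth L f"
    and minimizer: "\<And>y. f xstar \<le> f y"
    and noise_measurable: "\<And>k. k \<ge> 1 \<Longrightarrow> \<xi> k \<in> measurable M N"
    and oracle_measurable: "(\<lambda>(y, z). g y z) \<in> borel_measurable (borel \<Otimes>\<^sub>M N)"
    and init: "\<And>\<omega>. \<omega> \<in> space M \<Longrightarrow> x 0 \<omega> = x0" "\<And>\<omega>. \<omega> \<in> space M \<Longrightarrow> x 1 \<omega> = x0"
    and step: "\<And>k \<omega>. k \<ge> 1 \<Longrightarrow> \<omega> \<in> space M \<Longrightarrow>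
      x (k + 1) \<omega> = x k \<omega> + (real k / (real k + 2)) *\<^sub>R (x k \<omega> - x (k - 1) \<omega>)
        - (2 * sqrt (stepsize L k) / ((real k + 2) * sqrt (real k))) *\<^sub>R g (x k \<omega>) (\<xi> k \<omega>)"
    and unbiased: "\<And>k. k \<ge> 1 \<Longrightarrow>
      AE \<omega> in M. vec_cond_exp M (past_sigma M N \<xi> k) (\<lambda>\<omega>'. g (x k \<omega>') (\<xi> k \<omega>')) \<omega>
        = gradient f (x k \<omega>)"
    and second_moment: "\<And>k. k \<ge> 1 \<Longrightarrow>
      AE \<omega> in M. nn_cond_exp M (past_sigma M N \<xi> k)
          (\<lambda>\<omega>'. ennreal ((norm (g (x k \<omega>') (\<xi> k \<omega>')))\<^sup>2)) \<omega>
        \<le> ennreal ((norm (gradient f (x k \<omega>)))\<^sup>2 + \<sigma>\<^sup>2)"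
    and r_lim: "r \<longlonglongrightarrow> 0"
  shows "AE \<omega> in M.
    (\<lambda>k. r k * (sqrt (real k) / ln (real k)) * (f (x k \<omega>) - f xstar)) \<longlonglongrightarrow> 0 \<and>
    liminf (\<lambda>k. ereal (sqrt (real k) * ln (ln (real k + 2)) * (f (x k \<omega>) - f xstar))) = 0"
proof -
  interpret prob_space M by fact
  define \<alpha> where "\<alpha> k = 2 * sqrt (stepsize L k) / sqrt (real k)" for k
  have \<alpha>_eq: "\<alpha> = (\<lambda>k. 2 / L * (1 / (sqrt (real k) * ln (real k + 2))))"
    unfolding \<alpha>_def[abs_def] momentum_stepsize_eq[OF \<open>L > 0\<close>] ..
  interpret stochastic_momentum M N \<xi> g x f L \<sigma> x0 xstar \<alpha>
  proof unfold_locales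
    show "x (k + 1) \<omega> = x k \<omega> + (real k / (real k + 2)) *\<^sub>R (x k \<omega> - x (k - 1) \<omega>)
        - (\<alpha> k / (real k + 2)) *\<^sub>R g (x k \<omega>) (\<xi> k \<omega>)" if "k \<ge> 1" "\<omega> \<in> space M" for k \<omega>
      using step[OF that] by (simp add: \<alpha>_def mult.commute)
    show "\<alpha> k > 0" if "k \<ge> 1" for k
      using \<open>L > 0\<close> that by (simp add: \<alpha>_eq)
    show "\<alpha> (Suc k) \<le> 2 * (real k + 1) * (\<alpha> k - \<alpha> (Suc k))" if "k \<ge> 1" for k
      using momentum_stepsize_decay[OF \<open>L > 0\<close> that] by (simp add: \<alpha>_def)
    have "(\<lambda>k. 2 * (1 / (sqrt (real k) * ln (real k + 2)))) \<longlonglongrightarrow> 0" by real_asymp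
    then have "\<forall>\<^sub>F k in sequentially. 2 * (1 / (sqrt (real k) * ln (real k + 2))) < 1"
      by (rule order_tendstoD) simp
    then show "\<forall>\<^sub>F k in sequentially. L * \<alpha> k \<le> 1"
      by eventually_elim (use \<open>L > 0\<close> in \<open>simp add: \<alpha>_eq\<close>)
    have "(\<alpha> k)\<^sup>2 = (2 / L)\<^sup>2 * (1 / (real k * (ln (real k + 2))\<^sup>2))" for k
      by (simp add: \<alpha>_eq power_mult_distrib power_divide)
    then show "summable (\<lambda>k. (\<alpha> k)\<^sup>2)"
      using summable_mult[OF summable_inverse_k_ln_squared, of "(2 / L)\<^sup>2"] by simp
  qed (fact assms)+
  show ?thesis
    using gap_rates
  proof (rule AE_mp, intro AE_I2 impI conjI)
    fix \<omega>
    assume "(\<exists>B. \<forall>\<^sub>F k in sequentially. \<alpha> k * (real k + 1) * gap (x k \<omega>) \<le> B) \<and>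
      summable (\<lambda>k. \<alpha> (Suc k) * gap (x k \<omega>))"
    then obtain B where B: "\<forall>\<^sub>F k in sequentially. \<alpha> k * (real k + 1) * gap (x k \<omega>) \<le> B"
      and sum: "summable (\<lambda>k. \<alpha> (Suc k) * gap (x k \<omega>))" by blast
    have \<alpha>_nonneg: "\<alpha> k \<ge> 0" for k using \<open>L > 0\<close> by (simp add: \<alpha>_eq)
    have "(\<lambda>k. sqrt (real k) / ln (real k)) \<in> O(\<lambda>k. 1 / (sqrt (real k) * ln (real k + 2)) * (real k + 1))"
      by real_asymp
    also have "(\<lambda>k. 1 / (sqrt (real k) * ln (real k + 2)) * (real k + 1)) = (\<lambda>k. (L / 2) * (\<alpha> k * (real k + 1)))"
    proof
      fix k
      have "1 / (sqrt (real k) * ln (real k + 2)) = L / 2 * \<alpha> k"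
        using \<open>L > 0\<close> by (simp add: \<alpha>_eq)
      then show "1 / (sqrt (real k) * ln (real k + 2)) * (real k + 1) = L / 2 * (\<alpha> k * (real k + 1))"
        by (simp only: mult.assoc)
    qed
    also have "O(\<lambda>k. (L / 2) * (\<alpha> k * (real k + 1))) = O(\<lambda>k. \<alpha> k * (real k + 1))"
      using \<open>L > 0\<close> by simp
    finally have "(\<lambda>k. sqrt (real k) / ln (real k) * gap (x k \<omega>)) \<in> O(\<lambda>k. \<alpha> k * (real k + 1) * gap (x k \<omega>))"
      by (rule landau_o.big.mult_right)
    also have "(\<lambda>k. \<alpha> k * (real k + 1) * gap (x k \<omega>)) \<in> O(\<lambda>_. 1)"
    proof (rule bigoI)
      show "\<forall>\<^sub>F k in sequentially. norm (\<alpha> k * (real k + 1) * gap (x k \<omega>)) \<le> B * norm (1 :: real)"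
        using B by eventually_elim (use \<alpha>_nonneg gap_nonneg in simp)
    qed
    finally have "(\<lambda>k. r k * (sqrt (real k) / ln (real k) * gap (x k \<omega>))) \<in> o(\<lambda>_. 1 * 1)"
      using r_lim by (intro landau_o.small_big_mult smalloI_tendsto) auto
    then have "(\<lambda>k. r k * (sqrt (real k) / ln (real k) * gap (x k \<omega>)) / (1 * 1)) \<longlonglongrightarrow> 0"
      by (rule smalloD_tendsto)
    then show "(\<lambda>k. r k * (sqrt (real k) / ln (real k)) * (f (x k \<omega>) - f xstar)) \<longlonglongrightarrow> 0"
      by (simp add: gap_def mult.assoc)
    \<comment> \<open>a limit inferior above \<open>c > 0\<close> gives \<open>gap (x k \<omega>) \<ge> c / ?w k\<close> eventually,
      so that the convergent series dominates a divergent one\<close>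
    let ?w = "\<lambda>k. sqrt (real k) * ln (ln (real k + 2))"
    let ?q = "\<lambda>k. ?w k * gap (x k \<omega>)"
    have w_pos: "?w k > 0" if "k \<ge> 1" for k
    proof -
      have "ln (exp 1) < ln (real k + 2)"
        using e_less_272 that by (subst ln_less_cancel_iff) auto
      then show ?thesis using that by simp
    qed
    have q_nonneg: "0 \<le> ?q k" for k
      using w_pos[of k] gap_nonneg[of "x k \<omega>"] by (cases "k = 0") auto
    have "\<not> 0 < liminf (\<lambda>k. ereal (?q k))"
    proof
      assume "0 < liminf (\<lambda>k. ereal (?q k))"
      then obtain c where c: "0 < ereal c" "ereal c < liminf (\<lambda>k. ereal (?q k))"
        using ereal_dense2 by blast
      have "summable (\<lambda>k. 1 / (sqrt (real (k+1)) * ln (real (k+1) + 2) * ?w k))"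
      proof (rule summable_comparison_test_ev)
        show "summable (\<lambda>k. L / (2 * c) * (\<alpha> (Suc k) * gap (x k \<omega>)))"
          using sum by (rule summable_mult)
        from less_LiminfD[OF c(2)] eventually_ge_at_top[of 1]
        show "\<forall>\<^sub>F k in sequentially. norm (1 / (sqrt (real (k+1)) * ln (real (k+1) + 2) * ?w k))
            \<le> L / (2 * c) * (\<alpha> (Suc k) * gap (x k \<omega>))"
        proof eventually_elim
          case (elim k)
          let ?u = "1 / (sqrt (real (k+1)) * ln (real (k+1) + 2))"
          have w: "?w k > 0" using w_pos elim(2) .
          have u: "?u \<ge> 0" by simp
          have "?u * (c / ?w k) \<le> ?u * gap (x k \<omega>)"
            using elim(1) w u by (intro mult_left_mono) (simp_all add: pos_divide_le_eq mult.commute)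
          moreover have "\<alpha> (Suc k) = 2 / L * ?u" by (simp add: \<alpha>_eq)
          ultimately have "c * (?u / ?w k) \<le> c * (L / (2 * c) * (\<alpha> (Suc k) * gap (x k \<omega>)))"
            using c(1) \<open>L > 0\<close> by simp
          then have "?u / ?w k \<le> L / (2 * c) * (\<alpha> (Suc k) * gap (x k \<omega>))"
            using c(1) by (subst (asm) mult_le_cancel_left_pos) auto
          moreover have "norm (1 / (sqrt (real (k+1)) * ln (real (k+1) + 2) * ?w k)) = ?u / ?w k"
            using divide_nonneg_pos[OF u w]
            by (simp only: divide_divide_eq_left[symmetric] real_norm_def abs_of_nonneg)
          ultimately show ?case by simp
        qed
      qed
      with not_summable_inverse_k_ln_lnln show False by simp
    qed
    moreover have "0 \<le> liminf (\<lambda>k. ereal (?q k))"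
      using q_nonneg by (intro Liminf_bounded) (simp add: always_eventually)
    ultimately have "liminf (\<lambda>k. ereal (?q k)) = 0" by (metis antisym_conv1 less_le)
    then show "liminf (\<lambda>k. ereal (sqrt (real k) * ln (ln (real k + 2)) * (f (x k \<omega>) - f xstar))) = 0"
      by (simp add: gap_def)
  qed
qed

end
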